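(* Let $D$ be an integral domain with quotient field $K$, let $n$ be a positive integer and let $\precsim$ be a preorder on $\{1,\ldots,n\}$. Then the set $\operatorname{Int}_{\mathrm{M}_{\precsim}(K)}(\mathrm{M}_{\precsim}(D))$ of integer-valued polynomials with coefficients in $\mathrm{M}_{\precsim}(K)$ forms a subring of $\mathrm{M}_{\precsim}(K)[x]$. Moreover, when its elements are viewed as matrices whose entries are polynomials with scalar coefficients (via $\mathrm{M}_{\precsim}(K)[x]\cong \mathrm{M}_{\precsim}(K[x])$), $$\operatorname{Int}_{\mathrm{M}_{\precsim}(K)}(\mathrm{M}_{\precsim}(D))=\left\{(f_{ih})\in \mathrm{M}_{\precsim}(K[x]) \;\middle|\; f_{ih}\in \operatorname{Int}_K\left(\mathrm{M}_{\precsim}(D)^{[h,\infty)}\right)\text{ for every } i,h \text{ with } i\precsim h\right\}.$$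
   Context: All rings are unital, subrings share the same identity, and polynomial rings are taken in a central indeterminate $x$. For a commutative ring $R$, a positive integer $n$ and a preorder (reflexive transitive relation) $\precsim$ on $\{1,\ldots,n\}$, the structural matrix ring is $\mathrm{M}_{\precsim}(R)=\{(a_{ij})\in \mathrm{M}_n(R)\mid a_{ij}\neq 0\Rightarrow i\precsim j\}$, a subring of the ring $\mathrm{M}_n(R)$ of $n\times n$ matrices over $R$. Isomorphism: a polynomial $f=\sum_{k=0}^m F_kx^k\in \mathrm{M}_{\precsim}(R)[x]$ with $F_k=(f^{(k)}_{ij})$ is identified with the matrix $(f_{ij})\in \mathrm{M}_{\precsim}(R[x])$, where $f_{ij}=\sum_{k=0}^m f^{(k)}_{ij}x^k\in R[x]$. Evaluation is right substitution: for $f=\sum_k F_kx^k\in \mathrm{M}_{\precsim}(R)[x]$ and $A\in \mathrm{M}_{\precsim}(R)$, $f(A)=\sum_k F_kA^k$. $\operatorname{Int}_{\mathrm{M}_{\precsim}(K)}(\mathrm{M}_{\precsim}(D))=\{f\in \mathrm{M}_{\precsim}(K)[x]\mid \forall A\in \mathrm{M}_{\precsim}(D):\ f(A)\in \mathrm{M}_{\precsim}(D)\}$. For $h\in\{1,\ldots,n\}$ let $[h,\infty)=\{k\in\{1,\ldots,n\}\mid h\precsim k\}$. For an $n\times n$ matrix $A$, $A^{[h,\infty)}$ is the $n\times n$ matrix obtained from $A$ by replacing every entry whose row or column index is outside $[h,\infty)$ with zero, and $\mathrm{M}_{\precsim}(R)^{[h,\infty)}=\{A^{[h,\infty)}\mid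 A\in \mathrm{M}_{\precsim}(R)\}$. This is a ring with identity $I_n^{[h,\infty)}$ (where $I_n$ is the identity matrix), and when evaluating a scalar polynomial in $R[x]$ at an element $A$ of $\mathrm{M}_{\precsim}(R)^{[h,\infty)}$ one uses the convention $A^0:=I_n^{[h,\infty)}$. $\operatorname{Int}_K(\mathrm{M}_{\precsim}(D)^{[h,\infty)})=\{f\in K[x]\mid \forall A\in \mathrm{M}_{\precsim}(D)^{[h,\infty)}:\ f(A)\in \mathrm{M}_{\precsim}(D)^{[h,\infty)}\}$. *)

theory Defs
  imports
    "HOL-Algebra.UnivPoly"
    "HOL-Algebra.Subrings"
    "HOL-Algebra.QuotRing"
    "HOL-Computational_Algebra.Polynomial"
    "Jordan_Normal_Form.Matrix"
    "Jordan_Normal_Form.VS_Connect"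
begin

text \<open>
  Rows and columns of matrices are numbered from 0, so a preorder on the index set is a relation
  \<open>r\<close> with \<open>preorder_on {0..<n} r\<close>, and \<open>(i, j) \<in> r\<close> stands for \<open>i \<precsim> j\<close>.
  The coefficient ring \<open>R\<close> is a subset of an ambient type class ring, so that the matrix ring
  over a domain is literally contained in the one over its quotient field.
\<close>

definition structural_matrix_ring ::
    "'a::comm_ring_1 set \<Rightarrow> nat \<Rightarrow> (nat \<times> nat) set \<Rightarrow> 'a mat ring" where
  "structural_matrix_ring R n r = (ring_mat TYPE('a) n ())
     \<lparr>carrier := {A \<in> carrier_mat n n. elements_mat A \<subseteq> R \<and>
        (\<forall>i<n. \<forall>j<n. A $$ (i, j) \<noteq> 0 \<longrightarrow> (i, j) \<in> r)}\<rparr>"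

definition up_closure :: "nat \<Rightarrow> (nat \<times> nat) set \<Rightarrow> nat \<Rightarrow> nat set" where
  "up_closure n r h = {k. k < n \<and> (h, k) \<in> r}"

definition corner :: "nat \<Rightarrow> (nat \<times> nat) set \<Rightarrow> nat \<Rightarrow> 'a::zero mat \<Rightarrow> 'a mat" where
  "corner n r h A = mat n n (\<lambda>(i, j).
     if i \<in> up_closure n r h \<and> j \<in> up_closure n r h then A $$ (i, j) else 0)"

definition corner_ring ::
    "'a::comm_ring_1 set \<Rightarrow> nat \<Rightarrow> (nat \<times> nat) set \<Rightarrow> nat \<Rightarrow> 'a mat ring" where
  "corner_ring R n r h = (structural_matrix_ring R n r)
     \<lparr>carrier := corner n r h ` carrier (structural_matrix_ring R n r),
      one := corner n r h (1\<^sub>m n)\<rparr>"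

text \<open>
  Polynomials over the noncommutative ring \<open>structural_matrix_ring R n r\<close> are the elements of
  \<^const>\<open>UP\<close>, whose multiplication is convolution, i.e. the indeterminate is central.
  \<^const>\<open>eval\<close> puts the coefficients to the left of the powers of the argument, so with the
  identity as coefficient map it is right substitution.
\<close>

definition int_matrix_polys ::
    "'k::field set \<Rightarrow> nat \<Rightarrow> (nat \<times> nat) set \<Rightarrow> (nat \<Rightarrow> 'k mat) set" where
  "int_matrix_polys D n r =
     (let S = structural_matrix_ring (UNIV :: 'k set) n r;
          T = structural_matrix_ring D n r
      in {f \<in> carrier (UP S). \<forall>A\<in>carrier T. eval S S (\<lambda>X. X) A f \<in> carrier T})"

text \<open>
  The powers below are taken in \<^const>\<open>corner_ring\<close>, so that \<open>A\<close> to the power 0 is the identity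
  of that ring and not the identity matrix.
\<close>

definition corner_eval ::
    "nat \<Rightarrow> (nat \<times> nat) set \<Rightarrow> nat \<Rightarrow> 'k::field poly \<Rightarrow> 'k mat \<Rightarrow> 'k mat" where
  "corner_eval n r h f A =
     (let S = corner_ring (UNIV :: 'k set) n r h
      in \<Oplus>\<^bsub>S\<^esub>k\<in>{..degree f}. Polynomial.coeff f k \<cdot>\<^sub>m (A [^]\<^bsub>S\<^esub> k))"

definition int_scalar_polys ::
    "'k::field set \<Rightarrow> nat \<Rightarrow> (nat \<times> nat) set \<Rightarrow> nat \<Rightarrow> 'k poly set" where
  "int_scalar_polys D n r h =
     {f. \<forall>A\<in>carrier (corner_ring D n r h). corner_eval n r h f A \<in> carrier (corner_ring D n r h)}"

definition poly_to_mat ::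
    "nat \<Rightarrow> (nat \<times> nat) set \<Rightarrow> (nat \<Rightarrow> 'k::field mat) \<Rightarrow> 'k poly mat" where
  "poly_to_mat n r f =
     (let S = structural_matrix_ring (UNIV :: 'k set) n r
      in mat n n (\<lambda>(i, j). \<Sum>k\<le>deg S f.
           Polynomial.monom (up_ring.coeff (UP S) f k $$ (i, j)) k))"

lemma structural_matrix_ring_sel [simp]:
  "mult (structural_matrix_ring R n r) = (*)"
  "add (structural_matrix_ring R n r) = (+)"
  "one (structural_matrix_ring R n r) = 1\<^sub>m n"
  "zero (structural_matrix_ring R n r) = 0\<^sub>m n n"
  by (simp_all add: structural_matrix_ring_def ring_mat_def)

lemma carrier_structural_matrix_ring:
  "A \<in> carrier (structural_matrix_ring R n r) \<longleftrightarrow> A \<in> carrier_mat n n \<and>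
     (\<forall>i<n. \<forall>j<n. A $$ (i, j) \<in> R \<and> (A $$ (i, j) \<noteq> 0 \<longrightarrow> (i, j) \<in> r))"
  unfolding structural_matrix_ring_def by (fastforce simp: elements_mat_def)

lemma class_subring_closed:
  fixes R :: "'a::comm_ring_1 set"
  assumes "subring R (class_ring :: 'a ring)"
  shows "0 \<in> R" "1 \<in> R" "x \<in> R \<Longrightarrow> y \<in> R \<Longrightarrow> x + y \<in> R" "x \<in> R \<Longrightarrow> y \<in> R \<Longrightarrow> x * y \<in> R"
    "x \<in> R \<Longrightarrow> - x \<in> R" "(\<And>i. i \<in> I \<Longrightarrow> g i \<in> R) \<Longrightarrow> sum g I \<in> R"
proof -
  interpret subring R "class_ring :: 'a ring" by fact
  show z: "0 \<in> R" using subringE(2)[OF assms] by simp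
  show "1 \<in> R" using subringE(3)[OF assms] by simp
  show p: "x + y \<in> R" if "x \<in> R" "y \<in> R" for x y using subringE(7)[OF assms that] by simp
  show "x * y \<in> R" if "x \<in> R" "y \<in> R" for x y using subringE(6)[OF assms that] by simp
  show "- x \<in> R" if "x \<in> R" for x
    using subringE(5)[OF assms that] by (simp add: class_ring_simps)
  show "sum g I \<in> R" if "\<And>i. i \<in> I \<Longrightarrow> g i \<in> R"
    using that by (induction I rule: infinite_finite_induct) (auto simp: z p)
qed

lemma ring_structural_matrix_ring:
  fixes R :: "'a::comm_ring_1 set"
  assumes R: "subring R (class_ring :: 'a ring)" and r: "preorder_on {0..<n} r"
  shows "ring (structural_matrix_ring R n r)"
proof -
  let ?H = "carrier (structural_matrix_ring R n r)"
  note cl = class_subring_closed[OF R]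
  interpret M: ring "ring_mat TYPE('a) n ()" by (rule ring_mat)
  have refl: "(i, i) \<in> r" if "i < n" for i
    using r that by (auto simp: preorder_on_def refl_on_def)
  have tr: "(i, k) \<in> r" if "(i, j) \<in> r" "(j, k) \<in> r" for i j k
    using r that unfolding preorder_on_def by (meson transD)
  have "subring ?H (ring_mat TYPE('a) n ())"
  proof (rule M.subringI)
    show "?H \<subseteq> carrier (ring_mat TYPE('a) n ())"
      by (auto simp: carrier_structural_matrix_ring ring_mat_def)
    show "\<one>\<^bsub>ring_mat TYPE('a) n ()\<^esub> \<in> ?H"
      by (auto simp: carrier_structural_matrix_ring ring_mat_def cl refl)
    fix A B assume A: "A \<in> ?H" and B: "B \<in> ?H"
    have Ac: "A \<in> carrier_mat n n" using A by (simp add: carrier_structural_matrix_ring)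
    have "\<ominus>\<^bsub>ring_mat TYPE('a) n ()\<^esub> A = - A"
      by (rule M.minus_equality) (use Ac in \<open>auto simp: ring_mat_def\<close>)
    then show "\<ominus>\<^bsub>ring_mat TYPE('a) n ()\<^esub> A \<in> ?H"
      using A by (auto simp: carrier_structural_matrix_ring cl)
    show "A \<oplus>\<^bsub>ring_mat TYPE('a) n ()\<^esub> B \<in> ?H"
      using A B by (auto simp: carrier_structural_matrix_ring ring_mat_def cl) fastforce
    have "(A * B) $$ (i, j) \<in> R \<and> ((A * B) $$ (i, j) \<noteq> 0 \<longrightarrow> (i, j) \<in> r)" if "i < n" "j < n" for i j
    proof -
      have e: "(A * B) $$ (i, j) = (\<Sum>k\<in>{0..<n}. A $$ (i, k) * B $$ (k, j))"
        using A B that by (auto simp: carrier_structural_matrix_ring scalar_prod_def)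
      have "(A * B) $$ (i, j) \<in> R"
        unfolding e
      proof (rule cl(6))
        fix k assume "k \<in> {0..<n}"
        then have "A $$ (i, k) \<in> R" "B $$ (k, j) \<in> R"
          using A B that by (simp_all add: carrier_structural_matrix_ring)
        then show "A $$ (i, k) * B $$ (k, j) \<in> R" by (rule cl(4))
      qed
      moreover have "(i, j) \<in> r" if nz: "(A * B) $$ (i, j) \<noteq> 0"
      proof -
        obtain k where k: "k < n" "A $$ (i, k) * B $$ (k, j) \<noteq> 0"
          using nz unfolding e by (auto elim: sum.not_neutral_contains_not_neutral)
        then have "A $$ (i, k) \<noteq> 0" "B $$ (k, j) \<noteq> 0" by auto
        then show ?thesis
          using A B k(1) \<open>i < n\<close> \<open>j < n\<close> tr[of i k j] by (simp add: carrier_structural_matrix_ring)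
      qed
      ultimately show ?thesis by blast
    qed
    then show "A \<otimes>\<^bsub>ring_mat TYPE('a) n ()\<^esub> B \<in> ?H"
      using A B by (auto simp: carrier_structural_matrix_ring ring_mat_def)
  qed
  from M.subring_is_ring[OF this] show ?thesis
    by (simp add: structural_matrix_ring_def)
qed

lemma subring_UNIV: "subring UNIV (class_ring :: 'a::comm_ring_1 ring)"
proof -
  have "ring (class_ring :: 'a ring)" by unfold_locales
  from ring.carrier_is_subring[OF this] show ?thesis by simp
qed

lemma carrier_corner_ring:
  fixes R :: "'a::comm_ring_1 set"
  assumes R: "subring R (class_ring :: 'a ring)"
  shows "A \<in> carrier (corner_ring R n r h) \<longleftrightarrow> A \<in> carrier (structural_matrix_ring R n r) \<and>
     (\<forall>i<n. \<forall>j<n. i \<notin> up_closure n r h \<or> j \<notin> up_closure n r h \<longrightarrow> A $$ (i, j) = 0)"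
proof
  assume "A \<in> carrier (corner_ring R n r h)"
  then show "A \<in> carrier (structural_matrix_ring R n r) \<and>
     (\<forall>i<n. \<forall>j<n. i \<notin> up_closure n r h \<or> j \<notin> up_closure n r h \<longrightarrow> A $$ (i, j) = 0)"
    by (auto simp: corner_ring_def corner_def carrier_structural_matrix_ring
        class_subring_closed[OF R] split: if_splits)
next
  assume *: "A \<in> carrier (structural_matrix_ring R n r) \<and>
     (\<forall>i<n. \<forall>j<n. i \<notin> up_closure n r h \<or> j \<notin> up_closure n r h \<longrightarrow> A $$ (i, j) = 0)"
  then have "A = corner n r h A"
    by (auto simp: corner_def carrier_structural_matrix_ring intro!: eq_matI)
  with * show "A \<in> carrier (corner_ring R n r h)"
    by (auto simp: corner_ring_def)
qed

lemma ring_corner_ring: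
  fixes R :: "'a::comm_ring_1 set"
  assumes R: "subring R (class_ring :: 'a ring)" and r: "preorder_on {0..<n} r"
  shows "ring (corner_ring R n r h)"
proof -
  let ?S = "structural_matrix_ring R n r" and ?C = "corner_ring R n r h"
  interpret S: ring ?S by (rule ring_structural_matrix_ring[OF R r])
  note cl = class_subring_closed[OF R]
  note car = carrier_corner_ring[OF R, of _ n r h]
  have sel: "mult ?C = (*)" "add ?C = (+)" "zero ?C = 0\<^sub>m n n" "one ?C = corner n r h (1\<^sub>m n)"
    by (simp_all add: corner_ring_def)
  have sub: "A \<in> carrier ?S" "A \<in> carrier_mat n n" if "A \<in> carrier ?C" for A
    using that by (auto simp: car carrier_structural_matrix_ring)
  have one: "corner n r h (1\<^sub>m n) \<in> carrier ?C"
    using S.one_closed by (auto simp: corner_ring_def)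
  have mult: "A * B \<in> carrier ?C" if "A \<in> carrier ?C" "B \<in> carrier ?C" for A B
  proof -
    have "A * B \<in> carrier ?S"
      using S.m_closed[OF sub(1)[OF that(1)] sub(1)[OF that(2)]] by simp
    moreover have "(A * B) $$ (i, j) = 0"
      if ij: "i < n" "j < n" "i \<notin> up_closure n r h \<or> j \<notin> up_closure n r h" for i j
    proof -
      have "(A * B) $$ (i, j) = (\<Sum>k\<in>{0..<n}. A $$ (i, k) * B $$ (k, j))"
        using sub(2)[OF \<open>A \<in> carrier ?C\<close>] sub(2)[OF \<open>B \<in> carrier ?C\<close>] ij
        by (auto simp: scalar_prod_def)
      also have "\<dots> = 0"
        using \<open>A \<in> carrier ?C\<close> \<open>B \<in> carrier ?C\<close> ij unfolding car
        by (intro sum.neutral) auto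
      finally show ?thesis .
    qed
    ultimately show ?thesis by (simp add: car)
  qed
  have add: "A + B \<in> carrier ?C" if "A \<in> carrier ?C" "B \<in> carrier ?C" for A B
  proof -
    have "A + B \<in> carrier ?S"
      using S.a_closed[OF sub(1)[OF that(1)] sub(1)[OF that(2)]] by simp
    then show ?thesis
      using that sub(2)[OF that(1)] sub(2)[OF that(2)] unfolding car by auto
  qed
  have neg: "- A \<in> carrier ?C" if "A \<in> carrier ?C" for A
    using that by (auto simp: car carrier_structural_matrix_ring cl)
  have one_l: "corner n r h (1\<^sub>m n) * A = A" if A: "A \<in> carrier ?C" for A
  proof (rule eq_matI)
    fix i j assume "i < dim_row A" "j < dim_col A"
    then have ij: "i < n" "j < n" using sub[OF A] by auto
    have "(corner n r h (1\<^sub>m n) * A) $$ (i, j) =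
        (\<Sum>k\<in>{0..<n}. (corner n r h (1\<^sub>m n)) $$ (i, k) * A $$ (k, j))"
      using ij sub(2)[OF A] by (simp add: corner_def scalar_prod_def)
    also have "\<dots> =
        (\<Sum>k\<in>{0..<n}. if k = i then (if i \<in> up_closure n r h then A $$ (k, j) else 0) else 0)"
      using ij by (intro sum.cong) (auto simp: corner_def)
    also have "\<dots> = A $$ (i, j)" using ij A by (auto simp: car sum.delta)
    finally show "(corner n r h (1\<^sub>m n) * A) $$ (i, j) = A $$ (i, j)" .
  qed (use sub[OF A] in \<open>auto simp: corner_def\<close>)
  have one_r: "A * corner n r h (1\<^sub>m n) = A" if A: "A \<in> carrier ?C" for A
  proof (rule eq_matI)
    fix i j assume "i < dim_row A" "j < dim_col A"
    then have ij: "i < n" "j < n" using sub[OF A] by auto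
    have "(A * corner n r h (1\<^sub>m n)) $$ (i, j) =
        (\<Sum>k\<in>{0..<n}. A $$ (i, k) * (corner n r h (1\<^sub>m n)) $$ (k, j))"
      using ij sub(2)[OF A] by (simp add: corner_def scalar_prod_def)
    also have "\<dots> =
        (\<Sum>k\<in>{0..<n}. if k = j then (if j \<in> up_closure n r h then A $$ (i, k) else 0) else 0)"
      using ij by (intro sum.cong) (auto simp: corner_def)
    also have "\<dots> = A $$ (i, j)" using ij A by (auto simp: car sum.delta)
    finally show "(A * corner n r h (1\<^sub>m n)) $$ (i, j) = A $$ (i, j)" .
  qed (use sub[OF A] in \<open>auto simp: corner_def\<close>)
  show ?thesis
  proof (rule ringI)
    show "abelian_group ?C"
    proof (rule abelian_groupI, unfold sel)
      show "0\<^sub>m n n \<in> carrier ?C" by (auto simp: car carrier_structural_matrix_ring cl)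
      show "\<exists>B\<in>carrier ?C. B + A = 0\<^sub>m n n" if "A \<in> carrier ?C" for A
        using neg[OF that] sub[OF that] by (intro bexI[of _ "- A"]) auto
    qed (use sub add in \<open>auto intro: assoc_add_mat comm_add_mat\<close>)
    show "Group.monoid ?C"
      by (rule monoidI, unfold sel) (use sub mult one one_l one_r in \<open>auto intro: assoc_mult_mat\<close>)
  qed (use sub in \<open>auto simp: sel intro: add_mult_distrib_mat mult_add_distrib_mat\<close>)
qed

lemma finsum_structural_matrix_ring:
  fixes g :: "nat \<Rightarrow> 'a::comm_ring_1 mat"
  assumes r: "preorder_on {0..<n} r" and I: "finite I" and ij: "i < n" "j < n"
    and g: "\<And>k. k \<in> I \<Longrightarrow> g k \<in> carrier (structural_matrix_ring UNIV n r)"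
  shows "finsum (structural_matrix_ring UNIV n r) g I $$ (i, j) = (\<Sum>k\<in>I. g k $$ (i, j))"
proof -
  let ?S = "structural_matrix_ring (UNIV :: 'a set) n r"
  interpret S: ring ?S
    by (rule ring_structural_matrix_ring[OF _ r]) (rule subring_UNIV)
  show ?thesis
    using I g
  proof (induction I rule: finite_induct)
    case empty
    then show ?case using ij by simp
  next
    case (insert k I)
    have "finsum ?S g I \<in> carrier ?S" by (rule S.finsum_closed) (use insert in auto)
    moreover have "finsum ?S g (insert k I) = g k + finsum ?S g I"
      using insert by (subst S.finsum_insert) auto
    moreover have "finsum ?S g I $$ (i, j) = (\<Sum>k\<in>I. g k $$ (i, j))"
      using insert by blast
    ultimately show ?case
      using insert.hyps ij by (auto simp: carrier_structural_matrix_ring)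
  qed
qed

lemma poly_to_mat_coeff:
  fixes f :: "nat \<Rightarrow> 'k::field mat"
  assumes f: "f \<in> carrier (UP (structural_matrix_ring (UNIV :: 'k set) n r))" and ij: "i < n" "j < n"
  shows "Polynomial.coeff (poly_to_mat n r f $$ (i, j)) k = f k $$ (i, j)"
proof -
  let ?S = "structural_matrix_ring (UNIV :: 'k set) n r"
  have c: "up_ring.coeff (UP ?S) f = f" using f by (simp add: UP_def)
  obtain m where "bound (0\<^sub>m n n) m f" using f by (auto simp: UP_def up_def)
  then have "bound (0\<^sub>m n n) (deg ?S f) f"
    unfolding deg_def c by (metis LeastI structural_matrix_ring_sel(4))
  then have z: "f k $$ (i, j) = 0" if "k > deg ?S f"
    using that ij by (auto simp: bound_def)
  have "Polynomial.coeff (poly_to_mat n r f $$ (i, j)) k =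
      (\<Sum>l\<le>deg ?S f. if l = k then f l $$ (i, j) else 0)"
    using ij by (simp add: poly_to_mat_def Let_def c coeff_sum)
  also have "\<dots> = f k $$ (i, j)" using z by (auto simp: sum.delta)
  finally show ?thesis .
qed

lemma poly_to_mat_ring_iso:
  assumes r: "preorder_on {0..<n} r"
  shows "poly_to_mat n r \<in> ring_iso (UP (structural_matrix_ring (UNIV :: 'k::field set) n r))
           (structural_matrix_ring (UNIV :: 'k poly set) n r)"
proof -
  let ?S = "structural_matrix_ring (UNIV :: 'k set) n r"
    and ?P = "structural_matrix_ring (UNIV :: 'k poly set) n r"
  let ?phi = "poly_to_mat n r :: _ \<Rightarrow> 'k poly mat"
  interpret S: ring ?S
    by (rule ring_structural_matrix_ring[OF _ r]) (rule subring_UNIV)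
  interpret U: UP_ring ?S "UP ?S" by unfold_locales simp
  note co = poly_to_mat_coeff
  have fS: "f k \<in> carrier ?S" if "f \<in> carrier (UP ?S)" for f k
    using that by (auto simp: UP_def up_def)
  have dim: "?phi f \<in> carrier_mat n n" for f by (simp add: poly_to_mat_def Let_def)
  have eqI: "?phi f = F" if "f \<in> carrier (UP ?S)" "F \<in> carrier_mat n n"
    "\<And>i j k. i < n \<Longrightarrow> j < n \<Longrightarrow> f k $$ (i, j) = Polynomial.coeff (F $$ (i, j)) k" for f F
    by (rule eq_matI) (use that dim[of f] in \<open>auto intro!: poly_eqI simp: co\<close>)
  have clo: "?phi f \<in> carrier ?P" if f: "f \<in> carrier (UP ?S)" for f
  proof -
    have "(i, j) \<in> r" if ij: "i < n" "j < n" and nz: "?phi f $$ (i, j) \<noteq> 0" for i j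
    proof -
      obtain k where "f k $$ (i, j) \<noteq> 0"
        using nz co[OF f ij] by (metis leading_coeff_0_iff)
      then show ?thesis using fS[OF f, of k] ij by (auto simp: carrier_structural_matrix_ring)
    qed
    then show ?thesis using dim[of f] by (auto simp: carrier_structural_matrix_ring)
  qed
  have "?phi \<in> Ring.ring_hom (UP ?S) ?P"
  proof (rule ring_hom_memI)
    fix f g assume f: "f \<in> carrier (UP ?S)" and g: "g \<in> carrier (UP ?S)"
    have "(f \<oplus>\<^bsub>UP ?S\<^esub> g) k $$ (i, j) = Polynomial.coeff ((?phi f + ?phi g) $$ (i, j)) k"
      if "i < n" "j < n" for i j k
      using that f g fS[OF f, of k] fS[OF g, of k] dim[of f] dim[of g]
      by (auto simp: UP_def co[OF f] co[OF g] carrier_structural_matrix_ring)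
    then show "?phi (f \<oplus>\<^bsub>UP ?S\<^esub> g) = ?phi f \<oplus>\<^bsub>?P\<^esub> ?phi g"
      using f g dim by (intro eqI) auto
    have "(f \<otimes>\<^bsub>UP ?S\<^esub> g) k $$ (i, j) = Polynomial.coeff ((?phi f * ?phi g) $$ (i, j)) k"
      if ij: "i < n" "j < n" for i j k
    proof -
      have fg: "f l * g m \<in> carrier ?S" for l m
        using S.m_closed[OF fS[OF f] fS[OF g]] by simp
      have "(f \<otimes>\<^bsub>UP ?S\<^esub> g) k $$ (i, j) = (\<Sum>m\<le>k. (f m * g (k - m)) $$ (i, j))"
        using f g fg ij by (simp add: UP_def finsum_structural_matrix_ring[OF r])
      also have "\<dots> = (\<Sum>m\<le>k. \<Sum>l\<in>{0..<n}. f m $$ (i, l) * g (k - m) $$ (l, j))"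
      proof (rule sum.cong[OF refl])
        fix m
        show "(f m * g (k - m)) $$ (i, j) = (\<Sum>l\<in>{0..<n}. f m $$ (i, l) * g (k - m) $$ (l, j))"
          using ij fS[OF f, of m] fS[OF g, of "k - m"]
          by (auto simp: carrier_structural_matrix_ring scalar_prod_def)
      qed
      also have "\<dots> = (\<Sum>l\<in>{0..<n}. \<Sum>m\<le>k. f m $$ (i, l) * g (k - m) $$ (l, j))"
        by (rule sum.swap)
      also have "\<dots> = (\<Sum>l\<in>{0..<n}. Polynomial.coeff (?phi f $$ (i, l) * ?phi g $$ (l, j)) k)"
        using ij by (intro sum.cong) (auto simp: coeff_mult co[OF f] co[OF g])
      also have "\<dots> = Polynomial.coeff ((?phi f * ?phi g) $$ (i, j)) k"
        using ij dim[of f] dim[of g] by (auto simp: scalar_prod_def coeff_sum)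
      finally show ?thesis .
    qed
    then show "?phi (f \<otimes>\<^bsub>UP ?S\<^esub> g) = ?phi f \<otimes>\<^bsub>?P\<^esub> ?phi g"
      using f g dim[of f] dim[of g] by (intro eqI) auto
  next
    show "?phi \<one>\<^bsub>UP ?S\<^esub> = \<one>\<^bsub>?P\<^esub>"
    proof (rule eqI)
      show "\<one>\<^bsub>UP ?S\<^esub> \<in> carrier (UP ?S)" by (rule U.UP_one_closed)
    qed (auto simp: UP_def)
  qed (rule clo)
  moreover have "bij_betw ?phi (carrier (UP ?S)) (carrier ?P)"
    unfolding bij_betw_def
  proof (intro conjI inj_onI subset_antisym)
    fix f g assume f: "f \<in> carrier (UP ?S)" and g: "g \<in> carrier (UP ?S)" and eq: "?phi f = ?phi g"
    show "f = g"
    proof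
      fix k show "f k = g k"
        using fS[OF f, of k] fS[OF g, of k] co[OF f] co[OF g] eq
        by (intro eq_matI) (auto simp: carrier_structural_matrix_ring)
    qed
  next
    show "carrier ?P \<subseteq> ?phi ` carrier (UP ?S)"
    proof
      fix F assume F: "F \<in> carrier ?P"
      define f where "f k = mat n n (\<lambda>(i, j). Polynomial.coeff (F $$ (i, j)) k)" for k
      have "f k \<in> carrier ?S" for k
        using F by (auto simp: f_def carrier_structural_matrix_ring) (metis coeff_0)
      moreover have "bound (0\<^sub>m n n) (\<Sum>i<n. \<Sum>j<n. degree (F $$ (i, j))) f"
      proof
        fix k assume k: "(\<Sum>i<n. \<Sum>j<n. degree (F $$ (i, j))) < k"
        have "degree (F $$ (i, j)) < k" if "i < n" "j < n" for i j
        proof -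
          have "degree (F $$ (i, j)) \<le> (\<Sum>j<n. degree (F $$ (i, j)))"
            by (rule member_le_sum) (use that in auto)
          also have "\<dots> \<le> (\<Sum>i<n. \<Sum>j<n. degree (F $$ (i, j)))"
            by (rule member_le_sum[where f = "\<lambda>i. \<Sum>j<n. degree (F $$ (i, j))"]) (use that in auto)
          finally show ?thesis using k by simp
        qed
        then show "f k = 0\<^sub>m n n" by (auto simp: f_def coeff_eq_0 intro!: eq_matI)
      qed
      ultimately have f: "f \<in> carrier (UP ?S)" by (auto simp: UP_def up_def)
      have "?phi f = F"
        by (rule eqI[OF f]) (use F in \<open>auto simp: f_def carrier_structural_matrix_ring\<close>)
      with f show "F \<in> ?phi ` carrier (UP ?S)" by blast
    qed
  qed (use clo in auto)
  ultimately show ?thesis by (simp add: ring_iso_def)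
qed

end

theory Submission
  imports Defs "Jordan_Normal_Form.Gauss_Jordan_Elimination"
begin

text \<open>
  Write \<open>f = (f\<^sub>i\<^sub>h)\<close> and let \<open>p(A)\<close> be the value of a scalar polynomial \<open>p\<close> at \<open>A\<close>. Since
  coefficients stand to the left of the powers of \<open>A\<close>, the \<open>(i, j)\<close> entry of \<open>f(A)\<close> is
  \<open>\<Sum>\<^sub>h f\<^sub>i\<^sub>h(A)\<^sub>h\<^sub>j\<close>. It only sees row \<open>h\<close> of \<open>f\<^sub>i\<^sub>h(A)\<close>, and because \<open>A\<close> is structural, the rows of
  \<open>f\<^sub>i\<^sub>h(A)\<close> with index in \<open>[h, \<infinity>)\<close> depend only on the corner of \<open>A\<close> at \<open>h\<close>. Hence \<open>f\<^sub>i\<^sub>h\<close> is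
  integer-valued on that corner exactly if for all integral \<open>A\<close> the rows of \<open>f\<^sub>i\<^sub>h(A)\<close> in \<open>[h, \<infinity>)\<close>
  are integral (\<open>int_scalar_polys_iff_integral_above\<close>), and if this holds for all \<open>h\<close>, then \<open>f\<close> is
  clearly integer-valued.

  The work is in the converse: from integrality of the sums \<open>\<Sum>\<^sub>h g\<^sub>h(A)\<^sub>h\<^sub>j\<close> for all \<open>A\<close> one has to
  recover integrality of all rows \<open>b\<close> of \<open>g\<^sub>h(A)\<close> with \<open>h \<precsim> b\<close> (\<open>row_sums_integral_iff\<close>).
  Let \<open>U = 1 + E\<^sub>h\<^sub>b\<close> with \<open>b \<noteq> h\<close>. This is a unit of the integral structural ring, and evaluation
  commutes with conjugation, so replacing \<open>A\<close> by its conjugate by \<open>U\<close> adds row \<open>b\<close> of \<open>g\<^sub>h(A)\<close> to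
  the sum (up to multiplication by the unit \<open>U\<close> from the right). The difference of the two sums is
  the wanted row. There remains \<open>b = h\<close>. If \<open>h\<close> is equivalent to some \<open>a \<noteq> h\<close>, conjugation
  by \<open>1 + E\<^sub>a\<^sub>h\<close> shows that the sum of rows \<open>a\<close> and \<open>h\<close> of \<open>g\<^sub>h(A)\<close> is integral, and row \<open>a\<close> is
  known to be integral. Otherwise
  all elements of \<open>[h, \<infinity>)\<close> other than \<open>h\<close> are strictly above \<open>h\<close>; evaluating at the corner of \<open>A\<close>
  removes from the sum all indices outside \<open>[h, \<infinity>)\<close>, and the indices strictly above \<open>h\<close>
  contribute integral terms by induction, so the term of \<open>h\<close> is integral as well.

  The condition obtained is visibly closed under sums and products of scalar polynomials and
  becomes weaker as \<open>h\<close> increases, so the matrices that satisfy it are closed under matrix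
  multiplication. This proves that the integer-valued polynomials form a subring.
\<close>

section \<open>Values of scalar polynomials at a matrix\<close>

definition mat_eval :: "'a::comm_ring_1 poly \<Rightarrow> 'a mat \<Rightarrow> 'a mat" where
  "mat_eval p A = mat (dim_row A) (dim_row A)
     (\<lambda>(i, j). \<Sum>k\<le>degree p. Polynomial.coeff p k * (A ^\<^sub>m k) $$ (i, j))"

lemma mat_eval_carrier [simp]: "A \<in> carrier_mat n n \<Longrightarrow> mat_eval p A \<in> carrier_mat n n"
  by (auto simp: mat_eval_def)

lemma mat_eval_index:
  assumes "A \<in> carrier_mat n n" "i < n" "j < n" "degree p \<le> N"
  shows "mat_eval p A $$ (i, j) = (\<Sum>k\<le>N. Polynomial.coeff p k * (A ^\<^sub>m k) $$ (i, j))"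
proof -
  have "mat_eval p A $$ (i, j) = (\<Sum>k\<le>degree p. Polynomial.coeff p k * (A ^\<^sub>m k) $$ (i, j))"
    using assms by (simp add: mat_eval_def)
  also have "\<dots> = (\<Sum>k\<le>N. Polynomial.coeff p k * (A ^\<^sub>m k) $$ (i, j))"
    by (rule sum.mono_neutral_left) (use assms in \<open>auto simp: coeff_eq_0\<close>)
  finally show ?thesis .
qed

lemma mat_mult_index:
  assumes "A \<in> carrier_mat n n" "B \<in> carrier_mat n n" "i < n" "j < n"
  shows "(A * B) $$ (i, j) = (\<Sum>m<n. A $$ (i, m) * B $$ (m, j))"
  using assms by (auto simp: scalar_prod_def lessThan_atLeast0)

lemma mat_eval_0 [simp]: "A \<in> carrier_mat n n \<Longrightarrow> mat_eval 0 A = 0\<^sub>m n n"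
  by (rule eq_matI) (auto simp: mat_eval_def)

lemma mat_eval_add:
  assumes "A \<in> carrier_mat n n"
  shows "mat_eval (p + q) A = mat_eval p A + mat_eval q A"
proof (rule eq_matI)
  fix i j assume "i < dim_row (mat_eval p A + mat_eval q A)"
    "j < dim_col (mat_eval p A + mat_eval q A)"
  with assms have ij: "i < n" "j < n" by (auto simp: mat_eval_def)
  let ?N = "max (degree p) (degree q)"
  have "degree (p + q) \<le> ?N" by (rule degree_add_le_max)
  then show "mat_eval (p + q) A $$ (i, j) = (mat_eval p A + mat_eval q A) $$ (i, j)"
    using assms ij
    by (simp add: mat_eval_index[of A n i j _ ?N] distrib_right sum.distrib carrier_matD[OF mat_eval_carrier])
qed (use assms in \<open>auto simp: mat_eval_def\<close>)

lemma mat_eval_smult: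
  assumes "A \<in> carrier_mat n n"
  shows "mat_eval (Polynomial.smult c p) A = c \<cdot>\<^sub>m mat_eval p A"
proof (rule eq_matI)
  fix i j assume "i < dim_row (c \<cdot>\<^sub>m mat_eval p A)" "j < dim_col (c \<cdot>\<^sub>m mat_eval p A)"
  with assms have ij: "i < n" "j < n" by (auto simp: mat_eval_def)
  then show "mat_eval (Polynomial.smult c p) A $$ (i, j) = (c \<cdot>\<^sub>m mat_eval p A) $$ (i, j)"
    using assms
    by (simp add: mat_eval_index[of A n i j _ "degree p"] degree_smult_le sum_distrib_left
        carrier_matD[OF mat_eval_carrier] mult.assoc)
qed (use assms in \<open>auto simp: mat_eval_def\<close>)

text \<open>Horner's rule, which makes induction over the polynomial available for evaluation.\<close>

lemma mat_eval_pCons: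
  assumes A: "A \<in> carrier_mat n n"
  shows "mat_eval (pCons a p) A = a \<cdot>\<^sub>m 1\<^sub>m n + mat_eval p A * A"
proof (rule eq_matI)
  fix i j assume "i < dim_row (a \<cdot>\<^sub>m 1\<^sub>m n + mat_eval p A * A)"
    "j < dim_col (a \<cdot>\<^sub>m 1\<^sub>m n + mat_eval p A * A)"
  with A have ij: "i < n" "j < n" by (auto simp: mat_eval_def)
  have "mat_eval (pCons a p) A $$ (i, j)
      = (\<Sum>k\<le>Suc (degree p). Polynomial.coeff (pCons a p) k * (A ^\<^sub>m k) $$ (i, j))"
    using A ij by (intro mat_eval_index) (auto simp: degree_pCons_le)
  also have "\<dots> = a * 1\<^sub>m n $$ (i, j) + (\<Sum>k\<le>degree p. Polynomial.coeff p k * (A ^\<^sub>m k * A) $$ (i, j))"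
    using A by (subst sum.atMost_Suc_shift) simp
  also have "(\<Sum>k\<le>degree p. Polynomial.coeff p k * (A ^\<^sub>m k * A) $$ (i, j))
      = (\<Sum>k\<le>degree p. \<Sum>m<n. Polynomial.coeff p k * (A ^\<^sub>m k) $$ (i, m) * A $$ (m, j))"
    using A ij by (simp add: mat_mult_index[of _ n] sum_distrib_left mult.assoc del: index_mult_mat)
  also have "\<dots> = (\<Sum>m<n. mat_eval p A $$ (i, m) * A $$ (m, j))"
    using A ij
    by (subst sum.swap) (simp add: mat_eval_index[of A n i _ p "degree p"] sum_distrib_right)
  also have "\<dots> = (mat_eval p A * A) $$ (i, j)"
    using A ij by (simp add: mat_mult_index[of _ n] del: index_mult_mat)
  finally show "mat_eval (pCons a p) A $$ (i, j) = (a \<cdot>\<^sub>m 1\<^sub>m n + mat_eval p A * A) $$ (i, j)"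
    using A ij by (simp add: carrier_matD[OF mat_eval_carrier])
qed (use A in \<open>auto simp: mat_eval_def\<close>)

lemma mat_eval_mult:
  assumes A: "A \<in> carrier_mat n n"
  shows "mat_eval (p * q) A = mat_eval p A * mat_eval q A"
proof (induction q)
  case 0
  then show ?case using A by (auto simp: right_mult_zero_mat[OF mat_eval_carrier])
next
  case (pCons a q)
  let ?P = "mat_eval p A" and ?Q = "mat_eval q A"
  have c: "?P \<in> carrier_mat n n" "?Q \<in> carrier_mat n n" "?Q * A \<in> carrier_mat n n"
    using A mult_carrier_mat[OF mat_eval_carrier[OF A] A] by simp_all
  have "mat_eval (p * pCons a q) A = a \<cdot>\<^sub>m ?P + (0 \<cdot>\<^sub>m 1\<^sub>m n + ?P * ?Q * A)"
    using A pCons.IH by (simp add: mat_eval_add[of _ n] mat_eval_smult[of _ n] mat_eval_pCons[of _ n])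
  \<comment> \<open>The zero constant term of \<open>x p q\<close>, which Horner's rule leaves as a scalar matrix.\<close>
  also have "0 \<cdot>\<^sub>m 1\<^sub>m n = (0\<^sub>m n n :: 'a mat)" by (rule eq_matI) simp_all
  also have "0\<^sub>m n n + ?P * ?Q * A = ?P * ?Q * A"
    by (rule left_add_zero_mat[OF mult_carrier_mat[OF mult_carrier_mat[OF c(1,2)] A]])
  also have "?P * ?Q * A = ?P * (?Q * A)" by (rule assoc_mult_mat[OF c(1,2) A])
  also have "a \<cdot>\<^sub>m ?P + ?P * (?Q * A) = ?P * (a \<cdot>\<^sub>m 1\<^sub>m n + ?Q * A)"
    using c by (simp add: mult_add_distrib_mat[OF c(1) _ c(3)] mult_smult_distrib[of ?P n n _ n])
  also have "\<dots> = ?P * mat_eval (pCons a q) A"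
    using A by (simp add: mat_eval_pCons[of _ n])
  finally show ?case .
qed

lemma mat_eval_conj:
  assumes A: "A \<in> carrier_mat n n" and U: "U \<in> carrier_mat n n" and V: "V \<in> carrier_mat n n"
    and UV: "U * V = 1\<^sub>m n" and VU: "V * U = 1\<^sub>m n"
  shows "mat_eval p (U * A * V) = U * mat_eval p A * V"
proof (induction p)
  case 0
  have "U * A * V \<in> carrier_mat n n" using A U V by auto
  then show ?case using A U V by simp
next
  case (pCons a p)
  let ?P = "mat_eval p A"
  note mult = mult_carrier_mat[of _ n n _ n] and assoc = assoc_mult_mat[of _ n n _ n _ n]
  have P: "?P \<in> carrier_mat n n" using A by simp
  note PA = mult[OF P A] and AV = mult[OF A V] and UP = mult[OF U P]
  have UAV: "U * A * V \<in> carrier_mat n n" by (rule mult[OF mult[OF U A] V])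
  have "U * ?P * V * (U * A * V) = U * ?P * (V * (U * A * V))"
    by (rule assoc[OF UP V UAV])
  also have "U * A * V = U * (A * V)" by (rule assoc[OF U A V])
  also have "V * (U * (A * V)) = V * U * (A * V)" by (rule assoc[OF V U AV, symmetric])
  also have "\<dots> = A * V" unfolding VU by (rule left_mult_one_mat[OF AV])
  also have "U * ?P * (A * V) = U * ?P * A * V" by (rule assoc[OF UP A V, symmetric])
  also have "U * ?P * A = U * (?P * A)" by (rule assoc[OF U P A])
  finally have conj: "U * ?P * V * (U * A * V) = U * (?P * A) * V"
    unfolding assoc[OF U A V] .
  have "U * (a \<cdot>\<^sub>m 1\<^sub>m n + ?P * A) = U * (a \<cdot>\<^sub>m 1\<^sub>m n) + U * (?P * A)"
    by (rule mult_add_distrib_mat[OF U _ PA]) simp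
  also have "U * (a \<cdot>\<^sub>m 1\<^sub>m n) = a \<cdot>\<^sub>m U"
    using U by (simp add: mult_smult_distrib[of U n n _ n])
  finally have "U * (a \<cdot>\<^sub>m 1\<^sub>m n + ?P * A) * V = (a \<cdot>\<^sub>m U + U * (?P * A)) * V" by simp
  also have "\<dots> = a \<cdot>\<^sub>m U * V + U * (?P * A) * V"
    by (rule add_mult_distrib_mat[OF _ mult[OF U PA] V]) (use U in simp)
  also have "a \<cdot>\<^sub>m U * V = a \<cdot>\<^sub>m (U * V)"
    by (rule mult_smult_assoc_mat[OF U V])
  finally show ?case
    using pCons.IH A UAV UV conj by (simp add: mat_eval_pCons[of _ n])
qed

section \<open>Evaluation in structural matrix rings\<close>

locale structural_matrices =
  fixes D :: "'k::field set" and n :: nat and r :: "(nat \<times> nat) set"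
  assumes subring_D: "subring D (class_ring :: 'k ring)"
    and preorder_r: "preorder_on {0..<n} r"
begin

abbreviation MK :: "'k mat ring" where "MK \<equiv> structural_matrix_ring UNIV n r"
abbreviation MD :: "'k mat ring" where "MD \<equiv> structural_matrix_ring D n r"
abbreviation up :: "nat \<Rightarrow> nat set" where "up \<equiv> up_closure n r"

sublocale MK: ring MK
  by (rule ring_structural_matrix_ring[OF subring_UNIV preorder_r])

sublocale MD: ring MD
  by (rule ring_structural_matrix_ring[OF subring_D preorder_r])

lemmas D_closed = class_subring_closed[OF subring_D]

lemma D_diff: "x \<in> D \<Longrightarrow> y \<in> D \<Longrightarrow> x - y \<in> D"
  using D_closed(3)[of x "- y"] D_closed(5)[of y] by simp

lemma r_less: "(i, j) \<in> r \<Longrightarrow> i < n" "(i, j) \<in> r \<Longrightarrow> j < n"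
  using preorder_r by (auto simp: preorder_on_def)

lemma r_refl: "i < n \<Longrightarrow> (i, i) \<in> r"
  using preorder_r by (simp add: preorder_on_def refl_on_def)

lemma r_trans: "(i, j) \<in> r \<Longrightarrow> (j, k) \<in> r \<Longrightarrow> (i, k) \<in> r"
  using preorder_r unfolding preorder_on_def by (elim conjE) (rule transD)

lemma mem_up_iff: "k \<in> up h \<longleftrightarrow> (h, k) \<in> r"
  using r_less(2)[of h k] by (auto simp: up_closure_def)

lemma up_mono: "(h, j) \<in> r \<Longrightarrow> up j \<subseteq> up h"
  by (auto simp: mem_up_iff intro: r_trans)

lemma notin_up: "k \<in> up h \<Longrightarrow> l \<notin> up h \<Longrightarrow> (k, l) \<notin> r"
  unfolding mem_up_iff by (blast intro: r_trans)

lemma MK_dim: "A \<in> carrier MK \<Longrightarrow> A \<in> carrier_mat n n"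
  by (simp add: carrier_structural_matrix_ring)

lemma MD_MK: "A \<in> carrier MD \<Longrightarrow> A \<in> carrier MK"
  by (simp add: carrier_structural_matrix_ring)

lemma MK_zero: "A \<in> carrier MK \<Longrightarrow> i < n \<Longrightarrow> j < n \<Longrightarrow> (i, j) \<notin> r \<Longrightarrow> A $$ (i, j) = 0"
  by (auto simp: carrier_structural_matrix_ring)

lemma MD_iff: "A \<in> carrier MD \<longleftrightarrow> A \<in> carrier MK \<and> (\<forall>i<n. \<forall>j<n. A $$ (i, j) \<in> D)"
  by (auto simp: carrier_structural_matrix_ring)

lemma pow_eq: "A \<in> carrier MK \<Longrightarrow> A [^]\<^bsub>MK\<^esub> k = A ^\<^sub>m k"
  by (induction k) (auto simp: carrier_structural_matrix_ring)

lemma pow_MK: "A \<in> carrier MK \<Longrightarrow> A ^\<^sub>m k \<in> carrier MK"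
  using MK.nat_pow_closed[of A k] by (simp add: pow_eq)

lemma mat_eval_MK:
  assumes A: "A \<in> carrier MK"
  shows "mat_eval p A \<in> carrier MK"
proof -
  have "mat_eval p A $$ (i, j) = 0" if ij: "i < n" "j < n" "(i, j) \<notin> r" for i j
    using MK_zero[OF pow_MK[OF A] ij] MK_dim[OF A] ij
    by (simp add: mat_eval_index[of A n i j p "degree p"])
  then show ?thesis
    using mat_eval_carrier[OF MK_dim[OF A]] by (auto simp: carrier_structural_matrix_ring)
qed

lemma mat_eval_pCons_index:
  assumes "A \<in> carrier_mat n n" "i < n" "j < n"
  shows "mat_eval (pCons a p) A $$ (i, j)
      = (if i = j then a else 0) + (\<Sum>m<n. mat_eval p A $$ (i, m) * A $$ (m, j))"
  using assms mult_carrier_mat[OF mat_eval_carrier[OF assms(1), of p] assms(1)]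
  by (simp add: mat_eval_pCons[of _ n] mat_mult_index[of _ n] carrier_matD[OF mat_eval_carrier]
      del: index_mult_mat(1))

text \<open>
  A path that starts in \<open>[h, \<infinity>)\<close> never leaves this set, so the rows in \<open>[h, \<infinity>)\<close> of a value
  involve only rows of the argument in the same set.
\<close>

lemma mat_eval_rows_cong:
  assumes A: "A \<in> carrier MK" and B: "B \<in> carrier_mat n n"
    and eq: "\<And>k l. k \<in> up h \<Longrightarrow> l < n \<Longrightarrow> B $$ (k, l) = A $$ (k, l)"
    and k: "k \<in> up h" and l: "l < n"
  shows "mat_eval p B $$ (k, l) = mat_eval p A $$ (k, l)"
  using l
proof (induction p arbitrary: l)
  case 0
  then show ?case using MK_dim[OF A] B by simp
next
  case (pCons a p)
  have kn: "k < n" using k by (simp add: mem_up_iff r_less)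
  have "mat_eval p B $$ (k, m) * B $$ (m, l) = mat_eval p A $$ (k, m) * A $$ (m, l)"
    if m: "m < n" for m
  proof (cases "m \<in> up h")
    case True
    then show ?thesis using eq pCons m by simp
  next
    case False
    with k have "(k, m) \<notin> r" by (rule notin_up)
    then have "mat_eval p A $$ (k, m) = 0" by (rule MK_zero[OF mat_eval_MK[OF A] kn m])
    then show ?thesis using pCons.IH[OF m] by simp
  qed
  then show ?case
    using MK_dim[OF A] B kn pCons.prems by (simp add: mat_eval_pCons_index)
qed

section \<open>Corners\<close>

lemma corner_dim: "corner n r h A \<in> carrier_mat n n"
  by (simp add: corner_def)

lemma corner_index:
  "i < n \<Longrightarrow> j < n \<Longrightarrow> corner n r h A $$ (i, j) = (if i \<in> up h \<and> j \<in> up h then A $$ (i, j) else 0)"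
  by (simp add: corner_def)

lemma corner_MD:
  assumes "A \<in> carrier MD"
  shows "corner n r h A \<in> carrier MD"
  using assms by (auto simp: carrier_structural_matrix_ring corner_dim corner_index D_closed)

lemma corner_row_index:
  assumes A: "A \<in> carrier MK" and k: "k \<in> up h" and l: "l < n"
  shows "corner n r h A $$ (k, l) = A $$ (k, l)"
proof (cases "l \<in> up h")
  case True
  then show ?thesis using k l by (simp add: corner_index mem_up_iff r_less)
next
  case False
  with k have "(k, l) \<notin> r" by (rule notin_up)
  then show ?thesis
    using MK_zero[OF A _ l] k l False by (simp add: corner_index mem_up_iff r_less)
qed

lemma mat_eval_corner_row:
  assumes "A \<in> carrier MK" "k \<in> up h" "l < n"
  shows "mat_eval p (corner n r h A) $$ (k, l) = mat_eval p A $$ (k, l)"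
  by (rule mat_eval_rows_cong[OF assms(1) corner_dim _ assms(2,3)])
     (rule corner_row_index[OF assms(1)])

text \<open>
  The off-diagonal entries here vanish because the corner of \<open>A\<close> has zero rows outside \<open>[h, \<infinity>)\<close>.
  The constant term contributes only to the diagonal, which is avoided as \<open>i\<close> and \<open>j\<close> lie on
  different sides of \<open>[h, \<infinity>)\<close>. This is what removes the foreign summands of a row sum.
\<close>

lemma mat_eval_corner_outside:
  assumes A: "A \<in> carrier MK" and i: "i < n" "i \<notin> up h" and j: "j \<in> up h"
  shows "mat_eval p (corner n r h A) $$ (i, j) = 0"
  using j
proof (induction p arbitrary: j)
  case 0
  then show ?case using i by (simp add: mat_eval_0[OF corner_dim] mem_up_iff r_less)
next
  case (pCons a p)
  have jn: "j < n" using pCons.prems by (simp add: mem_up_iff r_less)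
  have "mat_eval p (corner n r h A) $$ (i, m) * corner n r h A $$ (m, j) = 0" if "m < n" for m
    using that jn pCons.IH[of m] by (cases "m \<in> up h") (auto simp: corner_index)
  then have "(\<Sum>m<n. mat_eval p (corner n r h A) $$ (i, m) * corner n r h A $$ (m, j)) = 0"
    by (intro sum.neutral) blast
  moreover have "i \<noteq> j" using i pCons.prems by auto
  ultimately show ?case
    using i jn by (simp only: mat_eval_pCons_index[OF corner_dim]) simp
qed

text \<open>
  Cutting to a corner is multiplicative since \<open>[h, \<infinity>)\<close> is closed upwards: an index \<open>m\<close>
  outside contributes nothing to an entry of \<open>A * B\<close> in a row of \<open>[h, \<infinity>)\<close>. As it also maps
  identity to identity, it carries ordinary powers to powers in the corner ring.
\<close>

lemma corner_mult:
  assumes A: "A \<in> carrier MK" and B: "B \<in> carrier_mat n n"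
  shows "corner n r h A * corner n r h B = corner n r h (A * B)"
proof (rule eq_matI)
  fix i j assume "i < dim_row (corner n r h (A * B))" "j < dim_col (corner n r h (A * B))"
  then have ij: "i < n" "j < n" by (auto simp: corner_def)
  note idx = corner_row_index[OF A]
  have "(corner n r h A * corner n r h B) $$ (i, j)
      = (\<Sum>m<n. corner n r h A $$ (i, m) * corner n r h B $$ (m, j))"
    using ij by (intro mat_mult_index corner_dim)
  also have "\<dots> = (\<Sum>m<n. if i \<in> up h \<and> j \<in> up h then A $$ (i, m) * B $$ (m, j) else 0)"
  proof (rule sum.cong[OF refl])
    fix m assume "m \<in> {..<n}"
    then have m: "m < n" by simp
    show "corner n r h A $$ (i, m) * corner n r h B $$ (m, j)
        = (if i \<in> up h \<and> j \<in> up h then A $$ (i, m) * B $$ (m, j) else 0)"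
    proof (cases "m \<in> up h")
      case True
      then show ?thesis using ij m by (simp add: corner_index)
    next
      case False
      then show ?thesis using ij m idx[of i h m] by (auto simp: corner_index)
    qed
  qed
  also have "\<dots> = corner n r h (A * B) $$ (i, j)"
    using ij MK_dim[OF A] B
    by (cases "i \<in> up h \<and> j \<in> up h") (auto simp: corner_index mat_mult_index[of _ n]
        simp del: index_mult_mat)
  finally show "(corner n r h A * corner n r h B) $$ (i, j) = corner n r h (A * B) $$ (i, j)" .
qed (auto simp: corner_def)

lemma corner_pow:
  assumes A: "A \<in> carrier MK"
  shows "corner n r h A [^]\<^bsub>corner_ring UNIV n r h\<^esub> (k::nat) = corner n r h (A ^\<^sub>m k)"
proof (induction k)
  case 0
  then show ?case using MK_dim[OF A] by (simp add: corner_ring_def)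
next
  case (Suc k)
  then show ?case
    using corner_mult[OF pow_MK[OF A] MK_dim[OF A]]
    by (simp add: corner_ring_def)
qed

lemma finsum_corner_ring_index:
  assumes "finite I" and "i < n" "j < n"
    and "\<And>k. k \<in> I \<Longrightarrow> g k \<in> carrier (corner_ring (UNIV :: 'k set) n r h)"
  shows "finsum (corner_ring UNIV n r h) g I \<in> carrier (corner_ring UNIV n r h)
     \<and> finsum (corner_ring UNIV n r h) g I $$ (i, j) = (\<Sum>k\<in>I. g k $$ (i, j))"
proof -
  let ?C = "corner_ring (UNIV :: 'k set) n r h"
  interpret C: ring ?C by (rule ring_corner_ring[OF subring_UNIV preorder_r])
  have dim: "A \<in> carrier_mat n n" if "A \<in> carrier ?C" for A
    using that by (auto simp: corner_ring_def corner_dim)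
  have sel: "zero ?C = 0\<^sub>m n n" "add ?C = (+)" by (simp_all add: corner_ring_def)
  show ?thesis
    using assms(1,4)
  proof (induction I rule: finite_induct)
    case empty
    then show ?case using assms(2,3) C.zero_closed by (simp add: sel)
  next
    case (insert k I)
    have "finsum ?C g (insert k I) = g k + finsum ?C g I"
      using insert by (subst C.finsum_insert) (auto simp: sel)
    moreover have "finsum ?C g (insert k I) \<in> carrier ?C"
      by (rule C.finsum_closed) (use insert in auto)
    ultimately show ?case
      using insert assms(2,3) dim[of "g k"] dim[of "finsum ?C g I"] by auto
  qed
qed

text \<open>
  Evaluation in the corner, with the corner identity as zeroth power, is ordinary evaluation
  followed by cutting to the corner.
\<close>

lemma corner_eval_eq:
  assumes A: "A \<in> carrier MK"
  shows "corner_eval n r h p (corner n r h A) = corner n r h (mat_eval p A)"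
proof -
  let ?C = "corner_ring (UNIV :: 'k set) n r h"
  have smult: "c \<cdot>\<^sub>m corner n r h M \<in> carrier ?C" if "M \<in> carrier MK" for c M
    using that
    by (auto simp: carrier_corner_ring[OF subring_UNIV] carrier_structural_matrix_ring
        corner_dim corner_index carrier_matD[OF corner_dim])
  have mem: "Polynomial.coeff p k \<cdot>\<^sub>m (corner n r h A [^]\<^bsub>?C\<^esub> k) \<in> carrier ?C" for k
    by (simp add: corner_pow[OF A] smult pow_MK[OF A])
  have fs: "i < n \<Longrightarrow> j < n \<Longrightarrow> corner_eval n r h p (corner n r h A) \<in> carrier ?C \<and>
      corner_eval n r h p (corner n r h A) $$ (i, j)
      = (\<Sum>k\<le>degree p. (Polynomial.coeff p k \<cdot>\<^sub>m (corner n r h A [^]\<^bsub>?C\<^esub> k)) $$ (i, j))" for i j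
    unfolding corner_eval_def Let_def by (rule finsum_corner_ring_index) (use mem in auto)
  interpret C: ring ?C by (rule ring_corner_ring[OF subring_UNIV preorder_r])
  have "corner_eval n r h p (corner n r h A) \<in> carrier ?C"
    unfolding corner_eval_def Let_def by (rule C.finsum_closed) (use mem in auto)
  then have dim: "corner_eval n r h p (corner n r h A) \<in> carrier_mat n n"
    by (auto simp: corner_ring_def corner_dim)
  show ?thesis
  proof (rule eq_matI)
    fix i j
    assume "i < dim_row (corner n r h (mat_eval p A))" "j < dim_col (corner n r h (mat_eval p A))"
    then have ij: "i < n" "j < n" by (auto simp: corner_def)
    have "corner_eval n r h p (corner n r h A) $$ (i, j)
        = (\<Sum>k\<le>degree p. Polynomial.coeff p k * corner n r h (A ^\<^sub>m k) $$ (i, j))"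
      using fs[OF ij] ij by (simp add: corner_pow[OF A] carrier_matD[OF corner_dim])
    also have "\<dots> = corner n r h (mat_eval p A) $$ (i, j)"
      using ij MK_dim[OF A]
      by (cases "i \<in> up h \<and> j \<in> up h")
         (auto simp: corner_index mat_eval_index[of A n i j p "degree p"])
    finally show "corner_eval n r h p (corner n r h A) $$ (i, j)
        = corner n r h (mat_eval p A) $$ (i, j)" .
  qed (use dim in \<open>auto simp: corner_def\<close>)
qed

text \<open>
  Integrality on the corner at \<open>h\<close>, rephrased for matrices of the full structural ring. This form
  avoids the different identity matrices of the corners and the full ring, so that different
  indices \<open>h\<close> can be compared. Asking for whole rows is no stronger than asking for the entries
  in the corner, because the other entries of these rows vanish.
\<close>

definition integral_above :: "nat \<Rightarrow> 'k poly \<Rightarrow> bool" where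
  "integral_above h p \<longleftrightarrow>
     (\<forall>A\<in>carrier MD. \<forall>k\<in>up h. \<forall>l<n. mat_eval p A $$ (k, l) \<in> D)"

lemma int_scalar_polys_iff_integral_above:
  "p \<in> int_scalar_polys D n r h \<longleftrightarrow> integral_above h p"
proof -
  have "corner_eval n r h p (corner n r h A) \<in> carrier (corner_ring D n r h) \<longleftrightarrow>
      (\<forall>k\<in>up h. \<forall>l<n. mat_eval p A $$ (k, l) \<in> D)" if "A \<in> carrier MD" for A
  proof -
    let ?M = "mat_eval p A"
    have M: "?M \<in> carrier MK" by (rule mat_eval_MK[OF MD_MK[OF that]])
    have "corner n r h ?M \<in> carrier (corner_ring D n r h) \<longleftrightarrow>
        (\<forall>i<n. \<forall>j<n. corner n r h ?M $$ (i, j) \<in> D)"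
      using M
      by (auto simp: carrier_corner_ring[OF subring_D] carrier_structural_matrix_ring corner_dim
          corner_index)
    also have "\<dots> \<longleftrightarrow> (\<forall>k\<in>up h. \<forall>l<n. ?M $$ (k, l) \<in> D)"
    proof (intro iffI ballI allI impI)
      fix k l assume "\<forall>i<n. \<forall>j<n. corner n r h ?M $$ (i, j) \<in> D" "k \<in> up h" "l < n"
      then show "?M $$ (k, l) \<in> D"
        using corner_row_index[OF M, of k h l] r_less by (metis mem_up_iff)
    next
      fix i j assume "\<forall>k\<in>up h. \<forall>l<n. ?M $$ (k, l) \<in> D" "i < n" "j < n"
      then show "corner n r h ?M $$ (i, j) \<in> D" by (auto simp: corner_index D_closed(1))
    qed
    finally show ?thesis by (simp add: corner_eval_eq[OF MD_MK[OF that]])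
  qed
  moreover have "carrier (corner_ring D n r h) = corner n r h ` carrier MD"
    by (simp add: corner_ring_def)
  ultimately show ?thesis by (simp add: int_scalar_polys_def integral_above_def)
qed

lemma integral_aboveD:
  "integral_above h p \<Longrightarrow> A \<in> carrier MD \<Longrightarrow> (h, k) \<in> r \<Longrightarrow> l < n \<Longrightarrow> mat_eval p A $$ (k, l) \<in> D"
  by (simp add: integral_above_def mem_up_iff)

lemma integral_above_antimono: "integral_above h p \<Longrightarrow> (h, j) \<in> r \<Longrightarrow> integral_above j p"
  using up_mono[of h j] unfolding integral_above_def by blast

lemma integral_above_add:
  assumes "integral_above h p" "integral_above h q"
  shows "integral_above h (p + q)"
  unfolding integral_above_def
proof (intro ballI allI impI)
  fix A k l assume A: "A \<in> carrier MD" and k: "k \<in> up h" and l: "l < n"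
  have Ac: "A \<in> carrier_mat n n" using A by (simp add: MK_dim MD_MK)
  have "mat_eval (p + q) A $$ (k, l) = mat_eval p A $$ (k, l) + mat_eval q A $$ (k, l)"
    using k l Ac by (simp add: mat_eval_add[OF Ac] carrier_matD[OF mat_eval_carrier] mem_up_iff r_less)
  then show "mat_eval (p + q) A $$ (k, l) \<in> D"
    using assms A k l by (simp add: integral_above_def D_closed(3))
qed

lemma integral_above_const:
  assumes "c \<in> D"
  shows "integral_above h [:c:]"
  unfolding integral_above_def
proof (intro ballI allI impI)
  fix A k l assume A: "A \<in> carrier MD" and k: "k \<in> up h" and l: "l < n"
  have Ac: "A \<in> carrier_mat n n" using A by (simp add: MK_dim MD_MK)
  have kn: "k < n" using k by (simp add: mem_up_iff r_less)
  show "mat_eval [:c:] A $$ (k, l) \<in> D"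
    using kn l Ac assms by (auto simp: mat_eval_pCons_index D_closed)
qed

lemma integral_above_0: "integral_above h 0"
  using integral_above_const[OF D_closed(1)] by simp

lemma integral_above_mult:
  assumes p: "integral_above h p" and q: "integral_above h q"
  shows "integral_above h (p * q)"
  unfolding integral_above_def
proof (intro ballI allI impI)
  fix A k l assume A: "A \<in> carrier MD" and k: "k \<in> up h" and l: "l < n"
  have Ac: "A \<in> carrier_mat n n" using A by (simp add: MK_dim MD_MK)
  have kn: "k < n" using k by (simp add: mem_up_iff r_less)
  have "mat_eval (p * q) A $$ (k, l) = (\<Sum>m<n. mat_eval p A $$ (k, m) * mat_eval q A $$ (m, l))"
    unfolding mat_eval_mult[OF Ac] using Ac kn l by (intro mat_mult_index) auto
  also have "\<dots> \<in> D"
  proof (rule D_closed(6))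
    fix m assume "m \<in> {..<n}"
    then have m: "m < n" by simp
    show "mat_eval p A $$ (k, m) * mat_eval q A $$ (m, l) \<in> D"
    proof (cases "m \<in> up h")
      case True
      then show ?thesis using p q A k l m by (auto simp: integral_above_def intro: D_closed(4))
    next
      case False
      with k have "(k, m) \<notin> r" by (rule notin_up)
      then have "mat_eval p A $$ (k, m) = 0" by (rule MK_zero[OF mat_eval_MK[OF MD_MK[OF A]] kn m])
      then show ?thesis by (simp add: D_closed(1))
    qed
  qed
  finally show "mat_eval (p * q) A $$ (k, l) \<in> D" .
qed

lemma integral_above_minus: "integral_above h p \<Longrightarrow> integral_above h (- p)"
  using integral_above_mult[OF integral_above_const[OF D_closed(5)[OF D_closed(2)]]] by simp

lemma integral_above_sum:
  "(\<And>m. m \<in> I \<Longrightarrow> integral_above h (g m)) \<Longrightarrow> integral_above h (sum g I)"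
  by (induction I rule: infinite_finite_induct) (auto intro: integral_above_add integral_above_0)

section \<open>Separating the summands of a row\<close>

text \<open>
  For \<open>U = 1 + E\<^sub>a\<^sub>b\<close> the value at the conjugate of \<open>A\<close> by \<open>U\<close>, multiplied by \<open>U\<close> from the right,
  is \<open>U p(A)\<close>, that is \<open>p(A)\<close> with row \<open>b\<close> added to row \<open>a\<close>. The factor \<open>U\<close> on the right is
  harmless, as it preserves integrality of rows.
\<close>

lemma transvection_conj:
  assumes A: "A \<in> carrier MD" and ab: "(a, b) \<in> r" "a \<noteq> b"
  obtains A' U where "A' \<in> carrier MD" "U \<in> carrier MD"
    "\<And>p. mat_eval p A' * U = addrow 1 a b (mat_eval p A)"
proof -
  let ?U = "addrow_mat n (1::'k) a b" and ?V = "addrow_mat n (- 1 :: 'k) a b"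
  have abn: "a < n" "b < n" using ab r_less by auto
  have Ac: "A \<in> carrier_mat n n" using A by (simp add: MK_dim MD_MK)
  have UV: "?U * ?V = 1\<^sub>m n" using addrow_mat_inv[OF abn ab(2), of 1] by simp
  have VU: "?V * ?U = 1\<^sub>m n" using addrow_mat_inv[OF abn ab(2), of "-1"] by simp
  have U: "?U \<in> carrier MD"
    using ab by (auto simp: carrier_structural_matrix_ring D_closed r_refl)
  have V: "?V \<in> carrier MD"
    using ab by (auto simp: carrier_structural_matrix_ring D_closed r_refl)
  have UAV: "?U * A * ?V \<in> carrier MD"
    using MD.m_closed[OF MD.m_closed[OF U A] V] by simp
  have "mat_eval p (?U * A * ?V) * ?U = addrow 1 a b (mat_eval p A)" for p
  proof -
    let ?P = "mat_eval p A"
    have P: "?P \<in> carrier_mat n n" using Ac by simp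
    have "mat_eval p (?U * A * ?V) * ?U = ?U * ?P * ?V * ?U"
      by (simp add: mat_eval_conj[OF Ac _ _ UV VU])
    also have "\<dots> = ?U * ?P * (?V * ?U)"
      by (rule assoc_mult_mat[of _ n n _ n _ n]) (use P in auto)
    also have "\<dots> = ?U * ?P"
      unfolding VU using P by (simp add: right_mult_one_mat[of _ n n])
    also have "\<dots> = addrow 1 a b ?P" using P abn by (simp add: addrow_mat[of _ n n])
    finally show ?thesis .
  qed
  from that[OF UAV U this] show thesis .
qed

definition row_sums_integral :: "(nat \<Rightarrow> 'k poly) \<Rightarrow> bool" where
  "row_sums_integral g \<longleftrightarrow>
     (\<forall>A\<in>carrier MD. \<forall>j<n. (\<Sum>c<n. mat_eval (g c) A $$ (c, j)) \<in> D)"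

text \<open>
  The conjugation by \<open>1 + E\<^sub>a\<^sub>b\<close> changes the row sums by row \<open>b\<close> of the value of the single
  polynomial \<open>g a\<close>.
\<close>

lemma row_sums_integral_off_diagonal:
  assumes g: "row_sums_integral g" and A: "A \<in> carrier MD" and ab: "(a, b) \<in> r" "a \<noteq> b"
    and j: "j < n"
  shows "mat_eval (g a) A $$ (b, j) \<in> D"
proof -
  obtain A' U where A': "A' \<in> carrier MD" and U: "U \<in> carrier MD"
    and conj: "\<And>p. mat_eval p A' * U = addrow 1 a b (mat_eval p A)"
    using transvection_conj[OF A ab] by blast
  have abn: "a < n" "b < n" using ab r_less by auto
  have dims: "A \<in> carrier_mat n n" "A' \<in> carrier_mat n n" "U \<in> carrier_mat n n"
    using A A' U by (simp_all add: MK_dim MD_MK)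
  let ?S = "\<lambda>A j. \<Sum>c<n. mat_eval (g c) A $$ (c, j)"
  have S: "?S B m \<in> D" if "B \<in> carrier MD" "m < n" for B m
    using g that by (simp add: row_sums_integral_def)
  have "(\<Sum>m<n. ?S A' m * U $$ (m, j)) = (\<Sum>c<n. (mat_eval (g c) A' * U) $$ (c, j))"
  proof -
    have "(mat_eval (g c) A' * U) $$ (c, j) = (\<Sum>m<n. mat_eval (g c) A' $$ (c, m) * U $$ (m, j))"
      if "c < n" for c
      using dims j that by (intro mat_mult_index) auto
    then show ?thesis
      by (subst sum_distrib_right, subst sum.swap) simp
  qed
  also have "\<dots> = (\<Sum>c<n. mat_eval (g c) A $$ (c, j)
      + (if c = a then mat_eval (g a) A $$ (b, j) else 0))"
    using dims j by (intro sum.cong) (auto simp: conj carrier_matD[OF mat_eval_carrier])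
  also have "\<dots> = ?S A j + mat_eval (g a) A $$ (b, j)"
    using abn by (simp add: sum.distrib)
  finally have "mat_eval (g a) A $$ (b, j) = (\<Sum>m<n. ?S A' m * U $$ (m, j)) - ?S A j" by simp
  moreover have "(\<Sum>m<n. ?S A' m * U $$ (m, j)) \<in> D"
    by (rule D_closed(6), rule D_closed(4)) (use U j S[OF A'] in \<open>auto simp: MD_iff\<close>)
  ultimately show ?thesis using S[OF A j] by (simp add: D_diff)
qed

text \<open>
  An index \<open>h\<close> that is equivalent to another one is reduced to the off-diagonal case by a
  conjugation. For any other \<open>h\<close>, all elements of \<open>[h, \<infinity>)\<close> apart from \<open>h\<close> have a strictly
  smaller upper set, so induction on its size covers every other summand that survives at the
  corner of \<open>A\<close>.
\<close>

lemma row_sums_integral_diagonal: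
  assumes g: "row_sums_integral g" and A: "A \<in> carrier MD" and h: "h < n" and j: "j < n"
  shows "mat_eval (g h) A $$ (h, j) \<in> D"
  using h A j
proof (induction "card (up h)" arbitrary: h A j rule: less_induct)
  case less
  note h = \<open>h < n\<close> and A = \<open>A \<in> carrier MD\<close> and j = \<open>j < n\<close>
  note off = row_sums_integral_off_diagonal[OF g]
  show ?case
  proof (cases "\<exists>a. (h, a) \<in> r \<and> (a, h) \<in> r \<and> a \<noteq> h")
    case True
    then obtain a where a: "(h, a) \<in> r" "(a, h) \<in> r" "a \<noteq> h" by blast
    obtain A' U where A': "A' \<in> carrier MD" and U: "U \<in> carrier MD"
      and conj: "\<And>p. mat_eval p A' * U = addrow 1 a h (mat_eval p A)"
      using transvection_conj[OF A a(2,3)] by blast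
    have dims: "A \<in> carrier_mat n n" "A' \<in> carrier_mat n n" "U \<in> carrier_mat n n"
      using A A' U by (simp_all add: MK_dim MD_MK)
    have an: "a < n" using a r_less by auto
    have "(mat_eval (g h) A' * U) $$ (a, j) = (\<Sum>m<n. mat_eval (g h) A' $$ (a, m) * U $$ (m, j))"
      using dims an j by (intro mat_mult_index) auto
    also have "\<dots> \<in> D"
      using U j off[OF A' a(1) a(3)[symmetric]]
      by (intro D_closed(6) D_closed(4)) (auto simp: MD_iff)
    finally have "mat_eval (g h) A $$ (h, j) + mat_eval (g h) A $$ (a, j) \<in> D"
      using dims an j by (simp add: conj carrier_matD[OF mat_eval_carrier])
    \<comment> \<open>Row \<open>a\<close> of \<open>g h\<close> is off-diagonal for \<open>h\<close>, hence integral, and can be subtracted.\<close>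
    from D_diff[OF this off[OF A a(1) a(3)[symmetric] j]] show ?thesis by simp
  next
    case False
    show ?thesis
    proof (cases "j \<in> up h")
      case out: False
      then have "mat_eval (g h) A $$ (h, j) = 0"
        using MK_zero[OF mat_eval_MK[OF MD_MK[OF A]] h j] by (simp add: mem_up_iff)
      then show ?thesis by (simp add: D_closed(1))
    next
      case j_up: True
      let ?B = "corner n r h A"
      have B: "?B \<in> carrier MD" by (rule corner_MD[OF A])
      have others: "mat_eval (g c) ?B $$ (c, j) \<in> D" if c: "c < n" "c \<noteq> h" for c
      proof (cases "c \<in> up h")
        case True
        have "h \<notin> up c" using False True c by (auto simp: mem_up_iff)
        moreover have "up c \<subseteq> up h" using True by (intro up_mono) (simp add: mem_up_iff)
        moreover have "h \<in> up h" using r_refl[OF h] by (simp add: mem_up_iff)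
        ultimately have "up c \<subset> up h" by blast
        moreover have "finite (up h)" by (simp add: up_closure_def)
        ultimately have "card (up c) < card (up h)" by (simp add: psubset_card_mono)
        then show ?thesis using less.hyps c(1) B j by blast
      next
        case out: False
        show ?thesis
          using mat_eval_corner_outside[OF MD_MK[OF A] c(1) out j_up] by (simp add: D_closed(1))
      qed
      let ?s = "\<lambda>c. mat_eval (g c) ?B $$ (c, j)"
      have all: "sum ?s {..<n} \<in> D"
        using g B j by (simp add: row_sums_integral_def)
      have rest: "sum ?s ({..<n} - {h}) \<in> D"
        using others by (intro D_closed(6)) auto
      have "sum ?s {..<n} = ?s h + sum ?s ({..<n} - {h})"
        using h by (intro sum.remove) auto
      then have "?s h = sum ?s {..<n} - sum ?s ({..<n} - {h})" by (rule eq_diff_eq[THEN iffD2, OF sym])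
      then have "?s h \<in> D" using D_diff[OF all rest] by (rule ssubst)
      then show ?thesis
        using mat_eval_corner_row[OF MD_MK[OF A] _ j, of h h] r_refl[OF h]
        by (simp add: mem_up_iff)
    qed
  qed
qed

text \<open>
  Applied to a row of a matrix of polynomials, this says that the entries of the row can be
  tested separately.
\<close>

lemma row_sums_integral_iff: "row_sums_integral g \<longleftrightarrow> (\<forall>h<n. integral_above h (g h))"
proof
  assume g: "row_sums_integral g"
  show "\<forall>h<n. integral_above h (g h)"
    unfolding integral_above_def
  proof (intro allI impI ballI)
    fix h A k l assume "h < n" "A \<in> carrier MD" "k \<in> up h" "l < n"
    then show "mat_eval (g h) A $$ (k, l) \<in> D"
      using row_sums_integral_off_diagonal[OF g] row_sums_integral_diagonal[OF g]
      by (cases "h = k") (auto simp: mem_up_iff)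
  qed
next
  assume "\<forall>h<n. integral_above h (g h)"
  then show "row_sums_integral g"
    unfolding row_sums_integral_def
    by (auto intro!: D_closed(6) integral_aboveD r_refl)
qed

section \<open>Integer-valued matrix polynomials\<close>

lemma eval_eq_finsum:
  assumes f: "f \<in> carrier (UP MK)" and A: "A \<in> carrier MK"
  shows "f k * A ^\<^sub>m k \<in> carrier MK"
    and "eval MK MK (\<lambda>X. X) A f = finsum MK (\<lambda>k. f k * A ^\<^sub>m k) {..deg MK f}"
proof -
  have "up_ring.coeff (UP MK) f = f" using f by (simp add: UP_def)
  then show "eval MK MK (\<lambda>X. X) A f = finsum MK (\<lambda>k. f k * A ^\<^sub>m k) {..deg MK f}"
    using f by (simp add: eval_def pow_eq[OF A])
  have "f k \<in> carrier MK" using f by (auto simp: UP_def up_def)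
  from MK.m_closed[OF this pow_MK[OF A]] show "f k * A ^\<^sub>m k \<in> carrier MK" by simp
qed

lemma eval_MK:
  assumes "f \<in> carrier (UP MK)" "A \<in> carrier MK"
  shows "eval MK MK (\<lambda>X. X) A f \<in> carrier MK"
  unfolding eval_eq_finsum(2)[OF assms]
  by (rule MK.finsum_closed) (use eval_eq_finsum(1)[OF assms] in blast)

lemma eval_index:
  assumes f: "f \<in> carrier (UP MK)" and A: "A \<in> carrier MK" and ij: "i < n" "j < n"
  shows "eval MK MK (\<lambda>X. X) A f $$ (i, j)
      = (\<Sum>h<n. mat_eval (poly_to_mat n r f $$ (i, h)) A $$ (h, j))"
proof -
  let ?F = "poly_to_mat n r f"
  have fk: "f k \<in> carrier MK" for k using f by (auto simp: UP_def up_def)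
  have deg: "degree (?F $$ (i, h)) \<le> deg MK f" if "h < n" for h
    using that ij unfolding poly_to_mat_def Let_def
    by (auto intro!: degree_sum_le order.trans[OF degree_monom_le])
  have "eval MK MK (\<lambda>X. X) A f $$ (i, j) = (\<Sum>k\<le>deg MK f. (f k * A ^\<^sub>m k) $$ (i, j))"
    unfolding eval_eq_finsum(2)[OF f A]
    by (rule finsum_structural_matrix_ring[OF preorder_r _ ij])
       (use eval_eq_finsum(1)[OF f A] in auto)
  also have "\<dots> = (\<Sum>k\<le>deg MK f. \<Sum>h<n. Polynomial.coeff (?F $$ (i, h)) k * (A ^\<^sub>m k) $$ (h, j))"
    using ij fk A
    by (intro sum.cong)
       (auto simp: mat_mult_index[of _ n] MK_dim poly_to_mat_coeff[OF f] simp del: index_mult_mat)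
  also have "\<dots> = (\<Sum>h<n. \<Sum>k\<le>deg MK f. Polynomial.coeff (?F $$ (i, h)) k * (A ^\<^sub>m k) $$ (h, j))"
    by (rule sum.swap)
  also have "\<dots> = (\<Sum>h<n. mat_eval (?F $$ (i, h)) A $$ (h, j))"
    using deg MK_dim[OF A] ij
    by (intro sum.cong) (auto simp: mat_eval_index[where n = n and N = "deg MK f"])
  finally show "eval MK MK (\<lambda>X. X) A f $$ (i, j)
      = (\<Sum>h<n. mat_eval (?F $$ (i, h)) A $$ (h, j))" .
qed

abbreviation PK :: "'k poly mat ring" where "PK \<equiv> structural_matrix_ring UNIV n r"

definition entries_integral :: "'k poly mat \<Rightarrow> bool" where
  "entries_integral F \<longleftrightarrow> (\<forall>i h. (i, h) \<in> r \<longrightarrow> integral_above h (F $$ (i, h)))"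

lemma poly_to_mat_PK: "f \<in> carrier (UP MK) \<Longrightarrow> poly_to_mat n r f \<in> carrier PK"
  using poly_to_mat_ring_iso[OF preorder_r]
  by (auto simp: ring_iso_def dest: ring_hom_closed)

lemma entries_integral_iff:
  assumes "F \<in> carrier PK"
  shows "entries_integral F \<longleftrightarrow> (\<forall>i<n. \<forall>h<n. integral_above h (F $$ (i, h)))"
proof
  assume F: "entries_integral F"
  show "\<forall>i<n. \<forall>h<n. integral_above h (F $$ (i, h))"
  proof (intro allI impI)
    fix i h assume ih: "i < n" "h < n"
    show "integral_above h (F $$ (i, h))"
    proof (cases "(i, h) \<in> r")
      case True
      then show ?thesis using F by (simp add: entries_integral_def)
    next
      case False
      then have "F $$ (i, h) = 0" using assms ih by (auto simp: carrier_structural_matrix_ring)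
      then show ?thesis by (simp add: integral_above_0)
    qed
  qed
next
  assume "\<forall>i<n. \<forall>h<n. integral_above h (F $$ (i, h))"
  then show "entries_integral F" by (simp add: entries_integral_def r_less)
qed

lemma int_matrix_polys_iff:
  "f \<in> int_matrix_polys D n r \<longleftrightarrow>
     f \<in> carrier (UP MK) \<and> entries_integral (poly_to_mat n r f)"
proof (cases "f \<in> carrier (UP MK)")
  case f: True
  let ?F = "poly_to_mat n r f"
  have "f \<in> int_matrix_polys D n r \<longleftrightarrow> (\<forall>i<n. row_sums_integral (\<lambda>h. ?F $$ (i, h)))"
  proof -
    have "eval MK MK (\<lambda>X. X) A f \<in> carrier MD \<longleftrightarrow>
        (\<forall>i<n. \<forall>j<n. (\<Sum>h<n. mat_eval (?F $$ (i, h)) A $$ (h, j)) \<in> D)"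
      if "A \<in> carrier MD" for A
      using eval_MK[OF f MD_MK[OF that]]
      by (simp add: MD_iff[of "eval _ _ _ _ _"] eval_index[OF f MD_MK[OF that]])
    then show ?thesis
      using f unfolding int_matrix_polys_def Let_def row_sums_integral_def by blast
  qed
  also have "\<dots> \<longleftrightarrow> entries_integral ?F"
    by (simp add: row_sums_integral_iff entries_integral_iff[OF poly_to_mat_PK[OF f]])
  finally show ?thesis using f by simp
next
  case False
  then show ?thesis by (simp add: int_matrix_polys_def Let_def)
qed

text \<open>
  In the product, \<open>F\<^sub>i\<^sub>m\<close> is integral above \<open>m\<close> and nonzero summands have \<open>m \<precsim> h\<close>, so both
  factors of \<open>F\<^sub>i\<^sub>m G\<^sub>m\<^sub>h\<close> are integral above \<open>h\<close>.
\<close>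

lemma entries_integral_mult:
  assumes F: "F \<in> carrier PK" "entries_integral F" and G: "G \<in> carrier PK" "entries_integral G"
  shows "entries_integral (F * G)"
  unfolding entries_integral_def
proof (intro allI impI)
  fix i h assume ih: "(i, h) \<in> r"
  have dims: "F \<in> carrier_mat n n" "G \<in> carrier_mat n n"
    using F G by (auto simp: carrier_structural_matrix_ring)
  have "integral_above h (F $$ (i, m) * G $$ (m, h))" if m: "m < n" for m
  proof (cases "(i, m) \<in> r \<and> (m, h) \<in> r")
    case True
    then have "integral_above m (F $$ (i, m))" "integral_above h (G $$ (m, h))"
      using F(2) G(2) by (auto simp: entries_integral_def)
    then show ?thesis using True integral_above_mult integral_above_antimono by blast
  next
    case False
    then have "F $$ (i, m) = 0 \<or> G $$ (m, h) = 0"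
      using F(1) G(1) m r_less[OF ih] by (auto simp: carrier_structural_matrix_ring)
    then show ?thesis using integral_above_0 by auto
  qed
  then have "integral_above h (\<Sum>m<n. F $$ (i, m) * G $$ (m, h))"
    by (intro integral_above_sum) auto
  then show "integral_above h ((F * G) $$ (i, h))"
    using r_less[OF ih] by (simp add: mat_mult_index[OF dims] del: index_mult_mat)
qed

lemma subring_int_matrix_polys: "subring (int_matrix_polys D n r) (UP MK)"
proof -
  let ?phi = "poly_to_mat n r"
  interpret U: UP_ring MK "UP MK" by unfold_locales simp
  interpret P: ring PK by (rule ring_structural_matrix_ring[OF subring_UNIV preorder_r])
  interpret phi: ring_hom_ring "UP MK" PK ?phi
    by (rule ring_hom_ringI2)
       (use U.ring_axioms P.ring_axioms poly_to_mat_ring_iso[OF preorder_r] in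
         \<open>auto simp: ring_iso_def\<close>)
  have PK_dim: "F \<in> carrier_mat n n" if "F \<in> carrier PK" for F
    using that by (simp add: carrier_structural_matrix_ring)
  have P_minus: "\<ominus>\<^bsub>PK\<^esub> F = - F" if "F \<in> carrier PK" for F
    by (rule P.minus_equality)
       (use that PK_dim[OF that] in \<open>auto simp: carrier_structural_matrix_ring\<close>)
  have phi_dim: "?phi f \<in> carrier_mat n n" if "f \<in> carrier (UP MK)" for f
    using that poly_to_mat_PK PK_dim by blast
  show ?thesis
  proof (rule U.subringI)
    show "int_matrix_polys D n r \<subseteq> carrier (UP MK)" by (auto simp: int_matrix_polys_iff)
    have "integral_above h (1\<^sub>m n $$ (i, h))" if "(i, h) \<in> r" for i h
      using integral_above_0 integral_above_const[OF D_closed(2)] r_less[OF that]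
      by (simp add: one_pCons)
    then show "\<one>\<^bsub>UP MK\<^esub> \<in> int_matrix_polys D n r"
      by (simp add: int_matrix_polys_iff entries_integral_def)
    fix f assume "f \<in> int_matrix_polys D n r"
    then have f: "f \<in> carrier (UP MK)" "entries_integral (?phi f)"
      by (auto simp: int_matrix_polys_iff)
    have "entries_integral (- ?phi f)"
      using f phi_dim[OF f(1)]
      by (simp add: entries_integral_def integral_above_minus r_less carrier_matD)
    then show "\<ominus>\<^bsub>UP MK\<^esub> f \<in> int_matrix_polys D n r"
      using f by (simp add: int_matrix_polys_iff P_minus poly_to_mat_PK)
    fix g assume "g \<in> int_matrix_polys D n r"
    then have g: "g \<in> carrier (UP MK)" "entries_integral (?phi g)"
      by (auto simp: int_matrix_polys_iff)
    show "f \<otimes>\<^bsub>UP MK\<^esub> g \<in> int_matrix_polys D n r"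
      using f g by (simp add: int_matrix_polys_iff entries_integral_mult poly_to_mat_PK)
    have "entries_integral (?phi f + ?phi g)"
      using f g phi_dim[OF f(1)] phi_dim[OF g(1)]
      by (simp add: entries_integral_def integral_above_add r_less carrier_matD)
    then show "f \<oplus>\<^bsub>UP MK\<^esub> g \<in> int_matrix_polys D n r"
      using f g by (simp add: int_matrix_polys_iff)
  qed
qed

lemma image_int_matrix_polys:
  "poly_to_mat n r ` int_matrix_polys D n r =
     {F \<in> carrier PK. \<forall>i h. (i, h) \<in> r \<longrightarrow> F $$ (i, h) \<in> int_scalar_polys D n r h}"
proof -
  have "poly_to_mat n r ` carrier (UP MK) = carrier PK"
    using poly_to_mat_ring_iso[OF preorder_r] by (auto simp: ring_iso_def bij_betw_def)
  moreover have "int_matrix_polys D n r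
      = {f \<in> carrier (UP MK). entries_integral (poly_to_mat n r f)}"
    by (auto simp: int_matrix_polys_iff)
  ultimately have "poly_to_mat n r ` int_matrix_polys D n r = {F \<in> carrier PK. entries_integral F}"
    by auto
  then show ?thesis
    by (simp add: entries_integral_def int_scalar_polys_iff_integral_above)
qed

end

theorem corollary4p14:
  fixes D :: "'k::field set" and n :: nat and r :: "(nat \<times> nat) set"
  assumes domain_D: "subdomain D (class_ring :: 'k ring)"
    and quotient_field: "\<forall>x::'k. \<exists>a\<in>D. \<exists>b\<in>D. b \<noteq> 0 \<and> x = a / b"
    and n_pos: "n \<ge> 1"
    and preorder: "preorder_on {0..<n} r"
  shows "subring (int_matrix_polys D n r) (UP (structural_matrix_ring (UNIV :: 'k set) n r))
    \<and> poly_to_mat n r ` int_matrix_polys D n r =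
        {F \<in> carrier (structural_matrix_ring (UNIV :: 'k poly set) n r).
           \<forall>i h. (i, h) \<in> r \<longrightarrow> F $$ (i, h) \<in> int_scalar_polys D n r h}"
proof -
  interpret structural_matrices D n r
    using domain_D preorder
    by (intro structural_matrices.intro subcring.axioms(1) subdomain.axioms(1))
  show ?thesis using subring_int_matrix_polys image_int_matrix_polys by blast
qed

end
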